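(* Let $n,m$ be non-negative integers. Every rate pair $(R_1,R_2)$ in the capacity region of the two-user symmetric linear deterministic interference channel with parameters $(n,m)$ and feedback model $(1000)$ satisfies $$2R_1+R_2\le (n-m)^+ +\max(n,m)+\max(m,n-m).$$
   Context: Symmetric linear deterministic interference channel with parameters $(n,m)$: let $q=\max(n,m)$ and let $\mathbf{S}$ be the $q\times q$ matrix over $\mathbb{F}_2$ with ones on the first diagonal below the main diagonal and zeros elsewhere. At time $j$, transmitter $\mathsf{T}_u$ ($u\in\{1,2\}$) sends $X_{uj}\in\mathbb{F}_2^q$ (first entry is the most significant bit), and the receivers $\mathsf{D}_1,\mathsf{D}_2$ receive $$Y_{1j}=\mathbf{S}^{q-n}X_{1j}\oplus \mathbf{S}^{q-m}X_{2j},\qquad Y_{2j}=\mathbf{S}^{q-n}X_{2j}\oplus \mathbf{S}^{q-m}X_{1j}.$$ Feedback model $(1000)$: there is a noiseless, strictly causal feedback link from receiver $\mathsf{D}_1$ to transmitter $\mathsf{T}_1$ only. Codes: for block length $N$, $W_u$ is uniform on $\{1,\dots,2^{NR_u}\}$, with $W_1,W_2$ independent. The encoders are $X_{1j}=f_{1j}(W_1,Y_1^{j-1})$ and $X_{2j}=f_{2j}(W_2)$, $j=1,\dots,N$, where $Y_1^{j-1}=(Y_{11},\dots,Y_{1,j-1})$. The decoder of $\mathsf{D}_u$ is a function $\widehat W_u=h_u(Y_u^N)$. A rate pair $(R_1,R_2)$ is achievable if there are codes with $\Pr(\widehat W_u\ne W_u)\to0$ as $N\to\infty$ for both $u=1,2$.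 The capacity region is the closure of the set of achievable rate pairs. Notation: $(x)^+=\max(x,0)$. *)

theory Defs
  imports
    "HOL-Probability.Probability"
    "HOL-Library.Z2"
    "Jordan_Normal_Form.Matrix"
begin

text \<open>Type \<open>bit\<close> is the field with two elements, so vector addition is the bitwise exclusive or.
  Index 0 of a vector is the most significant bit.\<close>

type_synonym bvec = "bit Matrix.vec"

definition shift_mat :: "nat \<Rightarrow> bit mat" where
  "shift_mat q = mat q q (\<lambda>(i, j). if i = j + 1 then 1 else 0)"

text \<open>What a receiver observes when its own transmitter sends \<open>x\<close> (direct gain \<open>n\<close>) and the other
  transmitter sends \<open>x'\<close> (cross gain \<open>m\<close>).\<close>

definition channel :: "nat \<Rightarrow> nat \<Rightarrow> bvec \<Rightarrow> bvec \<Rightarrow> bvec" where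
  "channel n m x x' = (let q = max n m; S = shift_mat q in
     (S ^\<^sub>m (q - n)) *\<^sub>v x + (S ^\<^sub>m (q - m)) *\<^sub>v x')"

text \<open>A code for feedback model (1000). The first argument of an encoder is the time, starting at 1.
  The list argument of \<open>enc1\<close> is the past output of receiver 1 in chronological order; this is the
  only feedback. A decoder is applied to the whole received block.\<close>

record code =
  enc1 :: "nat \<Rightarrow> nat \<Rightarrow> bvec list \<Rightarrow> bvec"
  enc2 :: "nat \<Rightarrow> nat \<Rightarrow> bvec"
  dec1 :: "bvec list \<Rightarrow> nat"
  dec2 :: "bvec list \<Rightarrow> nat"

text \<open>The message set \<open>{1, \<dots>, 2\<^sup>N\<^sup>R}\<close>; if the upper limit is not an integer, it is rounded down.\<close>

definition messages :: "nat \<Rightarrow> real \<Rightarrow> nat set" where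
  "messages N R = {w. 1 \<le> w \<and> real w \<le> 2 powr (real N * R)}"

definition valid_code :: "nat \<Rightarrow> nat \<Rightarrow> nat \<Rightarrow> real \<Rightarrow> real \<Rightarrow> code \<Rightarrow> bool" where
  "valid_code n m N R1 R2 c \<longleftrightarrow> (let q = max n m in
     (\<forall>j\<in>{1..N}. \<forall>w\<in>messages N R1. \<forall>ys. length ys = j - 1 \<and> set ys \<subseteq> carrier_vec q \<longrightarrow>
        enc1 c j w ys \<in> carrier_vec q) \<and>
     (\<forall>j\<in>{1..N}. \<forall>w\<in>messages N R2. enc2 c j w \<in> carrier_vec q))"

text \<open>\<open>Y1_block n m c w1 w2 j\<close> is \<open>[Y\<^sub>1\<^sub>1, \<dots>, Y\<^sub>1\<^sub>j]\<close> when the messages are \<open>w1\<close> and \<open>w2\<close>.\<close>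

primrec Y1_block :: "nat \<Rightarrow> nat \<Rightarrow> code \<Rightarrow> nat \<Rightarrow> nat \<Rightarrow> nat \<Rightarrow> bvec list" where
  "Y1_block n m c w1 w2 0 = []"
| "Y1_block n m c w1 w2 (Suc j) = Y1_block n m c w1 w2 j @
     [channel n m (enc1 c (Suc j) w1 (Y1_block n m c w1 w2 j)) (enc2 c (Suc j) w2)]"

definition X1 :: "nat \<Rightarrow> nat \<Rightarrow> code \<Rightarrow> nat \<Rightarrow> nat \<Rightarrow> nat \<Rightarrow> bvec" where
  "X1 n m c w1 w2 j = enc1 c j w1 (Y1_block n m c w1 w2 (j - 1))"

definition Y2_block :: "nat \<Rightarrow> nat \<Rightarrow> code \<Rightarrow> nat \<Rightarrow> nat \<Rightarrow> nat \<Rightarrow> bvec list" where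
  "Y2_block n m c w1 w2 N =
     map (\<lambda>j. channel n m (enc2 c j w2) (X1 n m c w1 w2 j)) [1..<Suc N]"

definition message_pmf :: "nat \<Rightarrow> real \<Rightarrow> real \<Rightarrow> (nat \<times> nat) pmf" where
  "message_pmf N R1 R2 = pair_pmf (pmf_of_set (messages N R1)) (pmf_of_set (messages N R2))"

definition error_prob1 :: "nat \<Rightarrow> nat \<Rightarrow> nat \<Rightarrow> real \<Rightarrow> real \<Rightarrow> code \<Rightarrow> real" where
  "error_prob1 n m N R1 R2 c = measure_pmf.prob (message_pmf N R1 R2)
     {(w1, w2). dec1 c (Y1_block n m c w1 w2 N) \<noteq> w1}"

definition error_prob2 :: "nat \<Rightarrow> nat \<Rightarrow> nat \<Rightarrow> real \<Rightarrow> real \<Rightarrow> code \<Rightarrow> real" where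
  "error_prob2 n m N R1 R2 c = measure_pmf.prob (message_pmf N R1 R2)
     {(w1, w2). dec2 c (Y2_block n m c w1 w2 N) \<noteq> w2}"

text \<open>Rates are non-negative; this also makes the message sets nonempty.\<close>

definition achievable :: "nat \<Rightarrow> nat \<Rightarrow> real \<Rightarrow> real \<Rightarrow> bool" where
  "achievable n m R1 R2 \<longleftrightarrow> 0 \<le> R1 \<and> 0 \<le> R2 \<and>
     (\<exists>C :: nat \<Rightarrow> code. (\<forall>N. valid_code n m N R1 R2 (C N)) \<and>
        (\<lambda>N. error_prob1 n m N R1 R2 (C N)) \<longlonglongrightarrow> 0 \<and>
        (\<lambda>N. error_prob2 n m N R1 R2 (C N)) \<longlonglongrightarrow> 0)"

definition capacity_region_1000 :: "nat \<Rightarrow> nat \<Rightarrow> (real \<times> real) set" where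
  "capacity_region_1000 n m = closure {(R1, R2). achievable n m R1 R2}"

end

theory Submission
  imports Defs
begin

text \<open>Let \<open>V\<^sub>u = S\<^sup>q\<^sup>-\<^sup>m X\<^sub>u\<close> be the interference caused by transmitter \<open>u\<close>. The entropy argument behind the
  bound reads
  \<open>N R\<^sub>1 \<le> I(W\<^sub>1; Y\<^sub>1) = H(Y\<^sub>1) - H(V\<^sub>2)\<close>,
  \<open>N R\<^sub>1 \<le> I(W\<^sub>1; Y\<^sub>1 | W\<^sub>2) \<le> H(V\<^sub>1 | W\<^sub>2) + H(Y\<^sub>1 | V\<^sub>1, W\<^sub>2)\<close>,
  \<open>N R\<^sub>2 \<le> I(W\<^sub>2; Y\<^sub>2, V\<^sub>2) = H(V\<^sub>2) + H(Y\<^sub>2 | V\<^sub>2) - H(V\<^sub>1 | W\<^sub>2)\<close>,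
  and in the sum everything cancels except \<open>H(Y\<^sub>1)\<close>, \<open>H(Y\<^sub>1 | V\<^sub>1, W\<^sub>2)\<close> and \<open>H(Y\<^sub>2 | V\<^sub>2)\<close>, which are bounded by
  counting free bits. Messages are uniform and the channel is deterministic, so entropies can be
  avoided: each of the three inequalities holds pointwise, up to a factor 8, for all but one eighth of
  the message pairs, with the entropies of \<open>V\<^sub>2\<close> and \<open>V\<^sub>1\<close> replaced by the sizes of the corresponding
  classes of messages. If both error probabilities are below 1/8, some pair is correctly decoded by
  both receivers and satisfies all three.\<close>

no_notation vec_nth (infixl "$" 90)

section \<open>Counting message pairs and received blocks\<close>

text \<open>A set filling at most the fraction \<open>1 / c\<close> of each class of a partition
  fills at most that fraction of the whole.\<close>

lemma card_fibres_le:
  assumes "finite S" "finite T"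
    and "\<And>y. y \<in> f ` S \<Longrightarrow> c * card {s \<in> S. f s = y} \<le> card {t \<in> T. f t = y}"
  shows "c * card S \<le> card T"
proof -
  have "c * card S = (\<Sum>y\<in>f ` S. c * card {s \<in> S. f s = y})"
    using sum.image_gen[OF assms(1), of "\<lambda>_. 1::nat" f] by (simp add: sum_distrib_left)
  also have "\<dots> \<le> (\<Sum>y\<in>f ` S. card {t \<in> T. f t = y})"
    by (rule sum_mono) (rule assms(3))
  also have "\<dots> = card (\<Union>y\<in>f ` S. {t \<in> T. f t = y})"
    using assms by (intro card_UN_disjoint[symmetric]) auto
  also have "\<dots> \<le> card T" using assms(2) by (intro card_mono) auto
  finally show ?thesis .
qed

text \<open>Division-free form of an averaging bound: at most \<open>Q\<close> fibres, each of size
  at most \<open>X / (c * Q)\<close>, have total size at most \<open>X / c\<close>.\<close>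

lemma card_le_by_fibres:
  assumes "finite S" "card (f ` S) \<le> Q"
    and "\<And>y. y \<in> f ` S \<Longrightarrow> c * Q * card {s \<in> S. f s = y} \<le> X"
  shows "c * card S \<le> X"
proof (cases "S = {}")
  case False
  then have "Q > 0" using assms(1,2) by (metis card_gt_0_iff finite_imageI image_is_empty le_zero_eq not_gr0)
  have "Q * (c * card S) = (\<Sum>y\<in>f ` S. c * Q * card {s \<in> S. f s = y})"
    using sum.image_gen[OF assms(1), of "\<lambda>_. 1::nat" f] by (simp add: sum_distrib_left algebra_simps)
  also have "\<dots> \<le> (\<Sum>y\<in>f ` S. X)" by (rule sum_mono) (rule assms(3))
  also have "\<dots> \<le> Q * X" using assms(2) by simp
  finally show ?thesis using \<open>Q > 0\<close> by simp
qed simp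

text \<open>Counting form of the entropy argument. The logarithms of \<open>Q\<close>,
  \<open>K\<close> and \<open>L\<close> stand for the bounds on \<open>H(Y\<^sub>1)\<close>,
  \<open>H(Y\<^sub>1 | V\<^sub>1, W\<^sub>2)\<close> and \<open>H(Y\<^sub>2 | V\<^sub>2)\<close>.
  The constant 512 is \<open>8 * 8 * 8\<close>, one factor 8 for each pointwise inequality.\<close>

lemma message_count_bound:
  fixes M1 :: "'a set" and M2 :: "'b set"
    and y1 :: "'a \<Rightarrow> 'b \<Rightarrow> 'y" and y2 :: "'a \<Rightarrow> 'b \<Rightarrow> 'z"
    and v1 :: "'a \<Rightarrow> 'b \<Rightarrow> 'v" and v2 :: "'b \<Rightarrow> 'w"
  assumes fin: "finite M1" "finite M2"
    and err1: "8 * card {(w1, w2) \<in> M1 \<times> M2. d1 (y1 w1 w2) \<noteq> w1} < card M1 * card M2"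
    and err2: "8 * card {(w1, w2) \<in> M1 \<times> M2. d2 (y2 w1 w2) \<noteq> w2} < card M1 * card M2"
    and y1: "card {y1 w1 w2 | w1 w2. w1 \<in> M1 \<and> w2 \<in> M2} \<le> Q"
    and y1_v1: "\<And>v w2. w2 \<in> M2 \<Longrightarrow> card {y1 w1 w2 | w1. w1 \<in> M1 \<and> v1 w1 w2 = v} \<le> K"
    and y2_v2: "\<And>v. card {y2 w1 w2 | w1 w2. w1 \<in> M1 \<and> w2 \<in> M2 \<and> v2 w2 = v} \<le> L"
    and v2: "\<And>w1 w2 w2'. w1 \<in> M1 \<Longrightarrow> w2 \<in> M2 \<Longrightarrow> w2' \<in> M2 \<Longrightarrow> y1 w1 w2 = y1 w1 w2' \<Longrightarrow> v2 w2 = v2 w2'"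
    and v1: "\<And>w1 w1' w2. w1 \<in> M1 \<Longrightarrow> w1' \<in> M1 \<Longrightarrow> w2 \<in> M2 \<Longrightarrow> y2 w1 w2 = y2 w1' w2 \<Longrightarrow> v1 w1 w2 = v1 w1' w2"
  shows "card M1 * card M1 * card M2 \<le> 512 * (Q * K * L)"
proof -
  \<comment> \<open>Up to normalisation these are the distribution of \<open>V\<^sub>2\<close> and that of \<open>V\<^sub>1\<close> given \<open>W\<^sub>2\<close>.\<close>
  define A where "A w2 = card {w2' \<in> M2. v2 w2' = v2 w2}" for w2
  define B where "B w1 w2 = card {w1' \<in> M1. v1 w1' w2 = v1 w1 w2}" for w1 w2
  define E1 where "E1 = {(w1, w2) \<in> M1 \<times> M2. d1 (y1 w1 w2) \<noteq> w1}"
  define E2 where "E2 = {(w1, w2) \<in> M1 \<times> M2. d2 (y2 w1 w2) \<noteq> w2}"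
  \<comment> \<open>Each of \<open>B1\<close>, \<open>B2\<close>, \<open>B3\<close> collects the
    pairs that violate one of the three inequalities although the receiver concerned decodes
    correctly. Correct decoding is what keeps their fibres small.\<close>
  define B1 where "B1 = {(w1, w2) \<in> M1 \<times> M2. d1 (y1 w1 w2) = w1 \<and> 8 * Q * A w2 < card M1 * card M2}"
  define B2 where "B2 = {(w1, w2) \<in> M1 \<times> M2. d1 (y1 w1 w2) = w1 \<and> 8 * K < B w1 w2}"
  define B3 where "B3 = {(w1, w2) \<in> M1 \<times> M2. d2 (y2 w1 w2) = w2 \<and> 8 * L * B w1 w2 < A w2 * card M1}"
  have fP: "finite (M1 \<times> M2)" using fin by simp
  have fB: "finite E1" "finite E2" "finite B1" "finite B2" "finite B3"
    by (auto simp: E1_def E2_def B1_def B2_def B3_def intro!: finite_subset[OF _ fP])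
  have b1: "8 * card B1 \<le> card M1 * card M2"
  proof (rule card_le_by_fibres[where f = "\<lambda>(w1, w2). y1 w1 w2" and Q = Q])
    let ?f = "\<lambda>(w1, w2). y1 w1 w2"
    have "{y1 w1 w2 | w1 w2. w1 \<in> M1 \<and> w2 \<in> M2} = ?f ` (M1 \<times> M2)" by auto
    then have "finite {y1 w1 w2 | w1 w2. w1 \<in> M1 \<and> w2 \<in> M2}" using fP by simp
    then have "card (?f ` B1) \<le> card {y1 w1 w2 | w1 w2. w1 \<in> M1 \<and> w2 \<in> M2}"
      by (rule card_mono) (auto simp: B1_def)
    then show "card (?f ` B1) \<le> Q" using y1 by linarith
    fix y assume "y \<in> ?f ` B1"
    then obtain a b where ab: "(a, b) \<in> B1" "y = y1 a b" by auto
    \<comment> \<open>The output \<open>y\<close> gives \<open>w1\<close> through the decoder, and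
      then \<open>v2\<close>. Only the class of \<open>b\<close> under \<open>v2\<close> is left
      open, so the fibre has at most \<open>A b\<close> elements.\<close>
    have "w1 = a \<and> v2 w2 = v2 b" if w: "(w1, w2) \<in> B1" "y1 w1 w2 = y" for w1 w2
    proof -
      have "w1 = a" using w ab by (simp add: B1_def)
      then show ?thesis using w ab v2[of a w2 b] by (simp add: B1_def)
    qed
    then have "{s \<in> B1. ?f s = y} \<subseteq> {a} \<times> {w2' \<in> M2. v2 w2' = v2 b}"
      by (auto simp: B1_def)
    then have "card {s \<in> B1. ?f s = y} \<le> card ({a} \<times> {w2' \<in> M2. v2 w2' = v2 b})"
      using fin by (intro card_mono) auto
    then have "card {s \<in> B1. ?f s = y} \<le> A b" by (simp add: A_def card_cartesian_product)
    then have "8 * Q * card {s \<in> B1. ?f s = y} \<le> 8 * Q * A b" by (rule mult_le_mono2)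
    also have "\<dots> \<le> card M1 * card M2" using ab by (simp add: B1_def)
    finally show "8 * Q * card {s \<in> B1. ?f s = y} \<le> card M1 * card M2" .
  qed (rule fB)
  have b2: "8 * card B2 \<le> card (M1 \<times> M2)"
  proof (rule card_fibres_le[where f = "\<lambda>(w1, w2). (w2, v1 w1 w2)"])
    let ?f = "\<lambda>(w1, w2). (w2, v1 w1 w2)"
    fix g assume "g \<in> ?f ` B2"
    then obtain a b where ab: "(a, b) \<in> B2" "g = (b, v1 a b)" by auto
    let ?Y = "{y1 w1 b | w1. w1 \<in> M1 \<and> v1 w1 b = v1 a b}"
    have fY: "finite ?Y" using fin by simp
    \<comment> \<open>With \<open>w2 = b\<close> fixed, decoding recovers the pair from
      \<open>y1\<close>, so the fibre has at most \<open>K\<close> elements, while the whole class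
      has \<open>B a b > 8 * K\<close>.\<close>
    have "card {s \<in> B2. ?f s = g} \<le> card ?Y"
    proof (rule card_inj_on_le[OF _ _ fY])
      show "inj_on (\<lambda>(w1, w2). y1 w1 w2) {s \<in> B2. ?f s = g}"
        by (rule inj_on_inverseI[where g = "\<lambda>y. (d1 y, b)"]) (clarsimp simp: B2_def ab(2))
      show "(\<lambda>(w1, w2). y1 w1 w2) ` {s \<in> B2. ?f s = g} \<subseteq> ?Y"
        by (rule image_subsetI) (auto simp: B2_def ab(2))
    qed
    also have "\<dots> \<le> K" using ab by (intro y1_v1) (auto simp: B2_def)
    finally have "8 * card {s \<in> B2. ?f s = g} \<le> B a b" using ab by (simp add: B2_def)
    also have "B a b = card ({w1' \<in> M1. v1 w1' b = v1 a b} \<times> {b})"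
      by (simp add: B_def card_cartesian_product)
    also have "{w1' \<in> M1. v1 w1' b = v1 a b} \<times> {b} = {t \<in> M1 \<times> M2. ?f t = g}"
      using ab by (auto simp: B2_def)
    finally show "8 * card {s \<in> B2. ?f s = g} \<le> card {t \<in> M1 \<times> M2. ?f t = g}" .
  qed (rule fB fP)+
  have b3: "8 * card B3 \<le> card (M1 \<times> M2)"
  proof (rule card_fibres_le[where f = "\<lambda>(w1, w2). v2 w2"])
    fix v assume "v \<in> (\<lambda>(w1, w2). v2 w2) ` B3"
    define C where "C = {s \<in> B3. (\<lambda>(w1, w2). v2 w2) s = v}"
    have C: "(a, b) \<in> C \<longleftrightarrow> (a, b) \<in> B3 \<and> v2 b = v" for a b by (auto simp: C_def)
    let ?f = "\<lambda>(w1, w2). y2 w1 w2"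
    \<comment> \<open>Within one class of \<open>v2\<close>, at most \<open>L\<close> outputs
      \<open>y2\<close> occur. Each reveals \<open>w2\<close> by decoding and then
      \<open>v1\<close>, which leaves at most \<open>B a b\<close> pairs per output.\<close>
    have "8 * card C \<le> card M1 * card {w2 \<in> M2. v2 w2 = v}"
    proof (rule card_le_by_fibres[where f = ?f and Q = L])
      show "finite C" using fB by (simp add: C_def)
      let ?Y = "{y2 w1 w2 | w1 w2. w1 \<in> M1 \<and> w2 \<in> M2 \<and> v2 w2 = v}"
      have "?Y \<subseteq> ?f ` (M1 \<times> M2)" by auto
      then have "finite ?Y" using fP finite_subset by blast
      moreover have "?f ` C \<subseteq> ?Y"
      proof (rule image_subsetI)
        fix p assume "p \<in> C"
        then show "?f p \<in> ?Y" by (cases p) (auto simp: C B3_def)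
      qed
      ultimately have "card (?f ` C) \<le> card ?Y" by (rule card_mono)
      then show "card (?f ` C) \<le> L" using y2_v2[of v] by linarith
      fix y assume "y \<in> ?f ` C"
      then obtain a b where ab: "(a, b) \<in> C" "y = y2 a b" by auto
      have "w2 = b \<and> v1 w1 b = v1 a b" if w: "(w1, w2) \<in> C" "y2 w1 w2 = y" for w1 w2
      proof -
        have "w2 = b" using w ab by (simp add: C B3_def)
        then show ?thesis using w ab v1[of w1 a b] by (simp add: C B3_def)
      qed
      then have "{s \<in> C. ?f s = y} \<subseteq> {w1' \<in> M1. v1 w1' b = v1 a b} \<times> {b}"
        by (auto simp: C B3_def)
      then have "card {s \<in> C. ?f s = y} \<le> card ({w1' \<in> M1. v1 w1' b = v1 a b} \<times> {b})"
        using fin by (intro card_mono) auto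
      then have "card {s \<in> C. ?f s = y} \<le> B a b" by (simp add: B_def card_cartesian_product)
      then have "8 * L * card {s \<in> C. ?f s = y} \<le> 8 * L * B a b" by (rule mult_le_mono2)
      also have "\<dots> \<le> A b * card M1" using ab by (simp add: C B3_def)
      finally show "8 * L * card {s \<in> C. ?f s = y} \<le> card M1 * card {w2 \<in> M2. v2 w2 = v}"
        using ab by (simp add: A_def C mult.commute)
    qed
    also have "\<dots> = card (M1 \<times> {w2 \<in> M2. v2 w2 = v})"
      by (simp add: card_cartesian_product)
    also have "M1 \<times> {w2 \<in> M2. v2 w2 = v} = {t \<in> M1 \<times> M2. (\<lambda>(w1, w2). v2 w2) t = v}" by auto
    finally show "8 * card {s \<in> B3. (\<lambda>(w1, w2). v2 w2) s = v}
        \<le> card {t \<in> M1 \<times> M2. (\<lambda>(w1, w2). v2 w2) t = v}" by (simp add: C_def)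
  qed (rule fB fP)+
  \<comment> \<open>Five exceptional sets, none exceeding one eighth of all pairs, cannot cover
    everything.\<close>
  have "card (E1 \<union> E2 \<union> B1 \<union> B2 \<union> B3) \<le> card E1 + card E2 + card B1 + card B2 + card B3"
    using card_Un_le[of "E1 \<union> E2 \<union> B1 \<union> B2" B3] card_Un_le[of "E1 \<union> E2 \<union> B1" B2]
      card_Un_le[of "E1 \<union> E2" B1] card_Un_le[of E1 E2] by linarith
  also have "\<dots> < card (M1 \<times> M2)"
    using b1 b2 b3 err1 err2 by (simp add: E1_def E2_def card_cartesian_product)
  finally have "\<not> M1 \<times> M2 \<subseteq> E1 \<union> E2 \<union> B1 \<union> B2 \<union> B3"
    using card_mono[of "E1 \<union> E2 \<union> B1 \<union> B2 \<union> B3" "M1 \<times> M2"] fB by auto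
  then obtain a b where "a \<in> M1" "b \<in> M2" "(a, b) \<notin> E1 \<union> E2 \<union> B1 \<union> B2 \<union> B3" by auto
  then have 1: "card M1 * card M2 \<le> 8 * Q * A b" and 2: "B a b \<le> 8 * K"
    and 3: "A b * card M1 \<le> 8 * L * B a b"
    by (auto simp: E1_def E2_def B1_def B2_def B3_def)
  \<comment> \<open>Chaining the inequalities at the pair \<open>(a, b)\<close> eliminates
    \<open>A b\<close> and \<open>B a b\<close>, as \<open>H(V\<^sub>2)\<close> and
    \<open>H(V\<^sub>1 | W\<^sub>2)\<close> cancel in the entropy sum.\<close>
  have "card M1 * card M1 * card M2 \<le> card M1 * (8 * Q * A b)"
    using mult_le_mono2[OF 1, of "card M1"] by (simp add: mult.assoc)
  also have "\<dots> = 8 * Q * (A b * card M1)" by simp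
  also have "\<dots> \<le> 8 * Q * (8 * L * B a b)" using 3 by (rule mult_le_mono2)
  also have "\<dots> \<le> 8 * Q * (8 * L * (8 * K))" using 2 by simp
  finally show ?thesis by (simp add: algebra_simps)
qed

text \<open>A block in \<open>Z\<close> is determined by its \<open>N * card F\<close> bits at the
  levels in \<open>F\<close>, since all other bits are common to the members of
  \<open>Z\<close>.\<close>

lemma card_vec_lists_le:
  fixes Z :: "bit Matrix.vec list set"
  assumes len: "\<And>a. a \<in> Z \<Longrightarrow> length a = N \<and> set a \<subseteq> carrier_vec q"
    and F: "F \<subseteq> {..<q}"
    and agree: "\<And>a b j i. a \<in> Z \<Longrightarrow> b \<in> Z \<Longrightarrow> j < N \<Longrightarrow> i < q \<Longrightarrow> i \<notin> F \<Longrightarrow> a ! j $ i = b ! j $ i"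
  shows "card Z \<le> 2 ^ (N * card F)"
proof -
  let ?g = "\<lambda>a. \<lambda>p\<in>{..<N} \<times> F. a ! fst p $ snd p"
  let ?P = "({..<N} \<times> F) \<rightarrow>\<^sub>E (UNIV :: bit set)"
  have fF: "finite F" using F finite_subset by blast
  have U: "(UNIV :: bit set) = {0, 1}" using bit.exhaust by blast
  have fin: "finite (UNIV :: bit set)" unfolding U by simp
  have c2: "card (UNIV :: bit set) = 2" unfolding U by simp
  have "inj_on ?g Z"
  proof (rule inj_onI)
    fix a b assume ab: "a \<in> Z" "b \<in> Z" "?g a = ?g b"
    show "a = b"
    proof (rule nth_equalityI)
      show "length a = length b" using len ab by simp
      fix j assume j: "j < length a"
      then have jN: "j < N" using len ab by simp
      have "a ! j \<in> carrier_vec q" "b ! j \<in> carrier_vec q"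
        using len[OF ab(1)] len[OF ab(2)] jN by (metis nth_mem subsetD)+
      moreover have "a ! j $ i = b ! j $ i" if "i < q" for i
      proof (cases "i \<in> F")
        case True
        then show ?thesis using fun_cong[OF ab(3), of "(j, i)"] jN by simp
      qed (use agree[OF ab(1,2) jN that] in simp)
      ultimately show "a ! j = b ! j" by (intro eq_vecI) auto
    qed
  qed
  moreover have "?g ` Z \<subseteq> ?P" by (auto split: if_splits)
  moreover have "finite ?P" using fin fF by (intro finite_PiE) auto
  ultimately have "card Z \<le> card ?P" by (rule card_inj_on_le)
  also have "card ?P = 2 ^ (N * card F)"
    using fF c2 by (simp add: card_PiE card_cartesian_product)
  finally show ?thesis .
qed

section \<open>Shift matrices and signal levels\<close>

lemma shift_mat_carrier [simp]: "shift_mat q \<in> carrier_mat q q"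
  by (simp add: shift_mat_def)

lemma index_shift_mat_pow_vec:
  assumes "x \<in> carrier_vec q" "i < q"
  shows "(shift_mat q ^\<^sub>m k *\<^sub>v x) $ i = (if k \<le> i then x $ (i - k) else 0)"
  using assms
proof (induction k arbitrary: x)
  case (Suc k)
  have S: "(shift_mat q *\<^sub>v x) $ i = (if 1 \<le> i then x $ (i - 1) else 0)" if "i < q" for i
  proof -
    have "(shift_mat q *\<^sub>v x) $ i = (\<Sum>j\<in>{0..<q}. (if i = j + 1 then 1 else 0) * x $ j)"
      using that Suc.prems by (simp add: shift_mat_def scalar_prod_def)
    \<comment> \<open>For \<open>i = 0\<close> truncated subtraction makes \<open>i - 1\<close>
      equal to 0; the inner condition removes that term.\<close>
    also have "\<dots> = (\<Sum>j\<in>{0..<q}. if j = i - 1 then if 1 \<le> i then x $ j else 0 else 0)"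
      by (rule sum.cong) auto
    also have "\<dots> = (if 1 \<le> i then x $ (i - 1) else 0)" using that by auto
    finally show ?thesis .
  qed
  have "shift_mat q ^\<^sub>m Suc k *\<^sub>v x = shift_mat q ^\<^sub>m k *\<^sub>v (shift_mat q *\<^sub>v x)"
    using Suc.prems by (simp add: assoc_mult_mat_vec[of _ q q _ q])
  moreover have "shift_mat q *\<^sub>v x \<in> carrier_vec q"
    using Suc.prems mult_mat_vec_carrier[OF shift_mat_carrier] by blast
  ultimately show ?case using Suc S by auto
qed (simp add: shift_mat_def)

text \<open>For \<open>k <= q\<close> this moves the top \<open>k\<close> bits of \<open>x\<close>
  to the lowest \<open>k\<close> of the \<open>q\<close> levels. The interference
  \<open>V\<^sub>u\<close> is the case \<open>k = m\<close>.\<close>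

definition level :: "nat \<Rightarrow> nat \<Rightarrow> bvec \<Rightarrow> bvec" where
  "level q k x = shift_mat q ^\<^sub>m (q - k) *\<^sub>v x"

lemma level_carrier [simp]: "level q k x \<in> carrier_vec q"
  unfolding level_def by (rule carrier_vecI) (simp add: carrier_matD(1)[OF shift_mat_carrier])

lemma dim_level [simp]: "dim_vec (level q k x) = q"
  using level_carrier by (rule carrier_vecD)

lemma level_index:
  assumes "x \<in> carrier_vec q" "i < q"
  shows "level q k x $ i = (if q - k \<le> i then x $ (i - (q - k)) else 0)"
  unfolding level_def using assms by (rule index_shift_mat_pow_vec)

text \<open>The shift loses only the low bits: bit \<open>i < k\<close> of the input reappears at
  level \<open>i + (q - k)\<close>.\<close>

lemma level_eqD:
  assumes "level q k x = level q k x'" "x \<in> carrier_vec q" "x' \<in> carrier_vec q" "i < k" "k \<le> q"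
  shows "x $ i = x' $ i"
proof -
  from \<open>k \<le> q\<close> obtain d where "q = k + d" by (rule less_eqE)
  then show ?thesis
    using arg_cong[OF assms(1), of "\<lambda>v. v $ (i + d)"] assms(2-4) by (simp add: level_index)
qed

lemma channel_level: "channel n m x x' = level (max n m) n x + level (max n m) m x'"
  by (simp add: channel_def level_def Let_def)

lemma channel_carrier [simp]: "channel n m x x' \<in> carrier_vec (max n m)"
  by (simp add: channel_level)

lemma channel_index:
  "i < max n m \<Longrightarrow> channel n m x x' $ i = level (max n m) n x $ i + level (max n m) m x' $ i"
  by (simp add: channel_level)

text \<open>A receiver output together with the intended input reveals the interference. This serves
  both receivers, with the roles of the transmitters exchanged.\<close>

lemma channel_cancel:
  assumes "channel n m x x' = channel n m x x''"
  shows "level (max n m) m x' = level (max n m) m x''"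
proof (rule eq_vecI)
  fix i assume i: "i < dim_vec (level (max n m) m x'')"
  then have "channel n m x x' $ i = channel n m x x'' $ i" using assms by simp
  with i show "level (max n m) m x' $ i = level (max n m) m x'' $ i"
    by (simp only: channel_index dim_level add_left_cancel)
qed simp

section \<open>Received blocks of a code\<close>

lemma length_Y1_block [simp]: "length (Y1_block n m c w1 w2 j) = j"
  by (induction j) simp_all

lemma set_Y1_block: "set (Y1_block n m c w1 w2 j) \<subseteq> carrier_vec (max n m)"
  by (induction j) simp_all

lemma nth_Y1_block:
  "i < j \<Longrightarrow> Y1_block n m c w1 w2 j ! i = channel n m (X1 n m c w1 w2 (Suc i)) (enc2 c (Suc i) w2)"
proof (induction j)
  case (Suc j)
  then show ?case by (cases "i = j") (simp_all add: nth_append X1_def)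
qed simp

text \<open>Lets equality of complete blocks be passed down to the feedback available at each
  time.\<close>

lemma take_Y1_block: "i \<le> j \<Longrightarrow> take i (Y1_block n m c w1 w2 j) = Y1_block n m c w1 w2 i"
proof (induction j)
  case (Suc j)
  then show ?case by (cases "i = Suc j") simp_all
qed simp

lemma length_Y2_block [simp]: "length (Y2_block n m c w1 w2 N) = N"
  by (simp add: Y2_block_def del: upt_Suc)

lemma set_Y2_block: "set (Y2_block n m c w1 w2 N) \<subseteq> carrier_vec (max n m)"
  by (auto simp: Y2_block_def simp del: upt_Suc)

lemma nth_Y2_block:
  "i < N \<Longrightarrow> Y2_block n m c w1 w2 N ! i = channel n m (enc2 c (Suc i) w2) (X1 n m c w1 w2 (Suc i))"
  by (simp add: Y2_block_def del: upt_Suc)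

lemma X1_carrier:
  assumes "valid_code n m N R1 R2 c" "w1 \<in> messages N R1" "j < N"
  shows "X1 n m c w1 w2 (Suc j) \<in> carrier_vec (max n m)"
proof -
  have "\<forall>j\<in>{1..N}. \<forall>w\<in>messages N R1. \<forall>ys. length ys = j - 1 \<and> set ys \<subseteq> carrier_vec (max n m) \<longrightarrow>
      enc1 c j w ys \<in> carrier_vec (max n m)"
    using assms(1) by (simp add: valid_code_def Let_def)
  from this[rule_format, of "Suc j" w1 "Y1_block n m c w1 w2 j"] assms(2,3)
  show ?thesis by (simp add: X1_def set_Y1_block)
qed

lemma enc2_carrier:
  assumes "valid_code n m N R1 R2 c" "w2 \<in> messages N R2" "j < N"
  shows "enc2 c (Suc j) w2 \<in> carrier_vec (max n m)"
  using assms by (auto simp: valid_code_def Let_def)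

section \<open>Message sets and error probabilities\<close>

lemma messages_eq: "messages N R = {1..nat \<lfloor>2 powr (real N * R)\<rfloor>}"
  by (auto simp: messages_def le_nat_iff le_floor_iff)

text \<open>Rounding down costs at most a factor 2, because the rounded value is at least 1 for a
  non-negative rate.\<close>

lemma card_messages_ge:
  assumes "0 \<le> R"
  shows "2 powr (real N * R) / 2 \<le> real (card (messages N R))" "0 < card (messages N R)"
proof -
  have "1 \<le> 2 powr (real N * R)" using assms by (intro ge_one_powr_ge_zero) auto
  then have 1: "1 \<le> \<lfloor>2 powr (real N * R)\<rfloor>" by simp
  moreover have "2 powr (real N * R) < real_of_int \<lfloor>2 powr (real N * R)\<rfloor> + 1" by linarith
  ultimately have "2 powr (real N * R) \<le> 2 * real_of_int \<lfloor>2 powr (real N * R)\<rfloor>" by linarith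
  then show "2 powr (real N * R) / 2 \<le> real (card (messages N R))" "0 < card (messages N R)"
    using 1 unfolding messages_eq by simp_all
qed

lemma prob_pair_pmf_of_set:
  assumes "finite A" "A \<noteq> {}" "finite B" "B \<noteq> {}"
  shows "measure_pmf.prob (pair_pmf (pmf_of_set A) (pmf_of_set B)) E
    = real (card (A \<times> B \<inter> E)) / real (card A * card B)"
proof -
  have "pair_pmf (pmf_of_set A) (pmf_of_set B) = pmf_of_set (A \<times> B)"
  proof (rule pmf_eqI)
    fix p
    have "A \<times> B \<noteq> {}" using assms by simp
    then show "pmf (pair_pmf (pmf_of_set A) (pmf_of_set B)) p = pmf (pmf_of_set (A \<times> B)) p"
      using assms by (cases p) (simp add: pmf_pair card_cartesian_product indicator_times)
  qed
  then show ?thesis using assms by (simp add: measure_pmf_of_set card_cartesian_product)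
qed

section \<open>The bound for a single code\<close>

text \<open>The summands of the exponent count free bits per channel use: in
  \<open>Y\<^sub>1\<close>, in \<open>Y\<^sub>1\<close> given \<open>V\<^sub>1\<close> and
  \<open>W\<^sub>2\<close>, and in \<open>Y\<^sub>2\<close> given \<open>V\<^sub>2\<close>.\<close>

lemma code_count_bound:
  assumes valid: "valid_code n m N R1 R2 c" and R: "0 \<le> R1" "0 \<le> R2"
    and e1: "error_prob1 n m N R1 R2 c < 1 / 8" and e2: "error_prob2 n m N R1 R2 c < 1 / 8"
  shows "card (messages N R1) * card (messages N R1) * card (messages N R2)
    \<le> 512 * 2 ^ (N * (max n m + (max n m - m) + (max n m - min m (n - m))))"
proof -
  define q where "q = max n m"
  \<comment> \<open>List positions start at 0 and times at 1, hence \<open>Suc j\<close>.\<close>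
  define V1 where "V1 w1 w2 = map (\<lambda>j. level q m (X1 n m c w1 w2 (Suc j))) [0..<N]" for w1 w2
  define V2 where "V2 w2 = map (\<lambda>j. level q m (enc2 c (Suc j) w2)) [0..<N]" for w2
  let ?M1 = "messages N R1" and ?M2 = "messages N R2"
  let ?Y1 = "\<lambda>w1 w2. Y1_block n m c w1 w2 N" and ?Y2 = "\<lambda>w1 w2. Y2_block n m c w1 w2 N"
  have nq: "n \<le> q" and mq: "m \<le> q" by (simp_all add: q_def)
  have fin: "finite ?M1" "finite ?M2" by (simp_all add: messages_eq)
  have ne: "?M1 \<noteq> {}" "?M2 \<noteq> {}" 
    using card_messages_ge(2)[OF R(1), of N] card_messages_ge(2)[OF R(2), of N] by auto
  have pos: "0 < card ?M1 * card ?M2" using fin ne by (simp add: card_gt_0_iff)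
  have X1: "X1 n m c w1 w2 (Suc j) \<in> carrier_vec q" if "w1 \<in> ?M1" "j < N" for w1 w2 j
    unfolding q_def using valid that by (rule X1_carrier)
  have X2: "enc2 c (Suc j) w2 \<in> carrier_vec q" if "w2 \<in> ?M2" "j < N" for w2 j
    unfolding q_def using valid that by (rule enc2_carrier)
  have Y1: "?Y1 w1 w2 ! j $ i = level q n (X1 n m c w1 w2 (Suc j)) $ i + level q m (enc2 c (Suc j) w2) $ i"
    if "j < N" "i < q" for w1 w2 i j
    using that by (simp add: nth_Y1_block channel_index q_def)
  have Y2: "?Y2 w1 w2 ! j $ i = level q n (enc2 c (Suc j) w2) $ i + level q m (X1 n m c w1 w2 (Suc j)) $ i"
    if "j < N" "i < q" for w1 w2 i j
    using that by (simp add: nth_Y2_block channel_index q_def)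
  have V1_eqD: "level q m (X1 n m c w1 w2 (Suc j)) = level q m (X1 n m c w1' w2' (Suc j))"
    if "V1 w1 w2 = V1 w1' w2'" "j < N" for w1 w2 w1' w2' j
    using arg_cong[OF that(1), of "\<lambda>v. v ! j"] that(2) by (simp add: V1_def)
  have V2_eqD: "level q m (enc2 c (Suc j) w2) = level q m (enc2 c (Suc j) w2')"
    if "V2 w2 = V2 w2'" "j < N" for w2 w2' j
    using arg_cong[OF that(1), of "\<lambda>v. v ! j"] that(2) by (simp add: V2_def)
  have "card ?M1 * card ?M1 * card ?M2
    \<le> 512 * (2 ^ (N * card {..<q}) * 2 ^ (N * card {m..<q}) * 2 ^ (N * card {min m (n - m)..<q}))"
  proof (rule message_count_bound[where ?y1.0 = ?Y1 and ?y2.0 = ?Y2 and ?v1.0 = V1 and ?v2.0 = V2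
        and ?d1.0 = "dec1 c" and ?d2.0 = "dec2 c"])
    show "finite ?M1" "finite ?M2" by (rule fin)+
    have "?M1 \<times> ?M2 \<inter> {(w1, w2). dec1 c (?Y1 w1 w2) \<noteq> w1}
        = {(w1, w2) \<in> ?M1 \<times> ?M2. dec1 c (?Y1 w1 w2) \<noteq> w1}" by auto
    then show "8 * card {(w1, w2) \<in> ?M1 \<times> ?M2. dec1 c (?Y1 w1 w2) \<noteq> w1} < card ?M1 * card ?M2"
      using e1 pos fin ne
      by (simp add: error_prob1_def message_pmf_def prob_pair_pmf_of_set divide_less_eq flip: of_nat_mult)
    have "?M1 \<times> ?M2 \<inter> {(w1, w2). dec2 c (?Y2 w1 w2) \<noteq> w2}
        = {(w1, w2) \<in> ?M1 \<times> ?M2. dec2 c (?Y2 w1 w2) \<noteq> w2}" by auto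
    then show "8 * card {(w1, w2) \<in> ?M1 \<times> ?M2. dec2 c (?Y2 w1 w2) \<noteq> w2} < card ?M1 * card ?M2"
      using e2 pos fin ne
      by (simp add: error_prob2_def message_pmf_def prob_pair_pmf_of_set divide_less_eq flip: of_nat_mult)
    show "card {?Y1 w1 w2 | w1 w2. w1 \<in> ?M1 \<and> w2 \<in> ?M2} \<le> 2 ^ (N * card {..<q})"
    proof (rule card_vec_lists_le[where q = q])
      show "length a = N \<and> set a \<subseteq> carrier_vec q"
        if "a \<in> {?Y1 w1 w2 | w1 w2. w1 \<in> ?M1 \<and> w2 \<in> ?M2}" for a
        using that set_Y1_block unfolding q_def by fastforce
    qed auto
    show "card {?Y1 w1 w2 | w1. w1 \<in> ?M1 \<and> V1 w1 w2 = v} \<le> 2 ^ (N * card {m..<q})"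
      if w2: "w2 \<in> ?M2" for v w2
    proof (rule card_vec_lists_le[where q = q])
      let ?Z = "{?Y1 w1 w2 | w1. w1 \<in> ?M1 \<and> V1 w1 w2 = v}"
      show "length a = N \<and> set a \<subseteq> carrier_vec q" if "a \<in> ?Z" for a
        using that set_Y1_block unfolding q_def by fastforce
      fix a b j i assume "a \<in> ?Z" "b \<in> ?Z" and ji: "j < N" "i < q" "i \<notin> {m..<q}"
      then obtain u w where u: "a = ?Y1 u w2" "u \<in> ?M1" and w: "b = ?Y1 w w2" "w \<in> ?M1"
        and V: "V1 u w2 = V1 w w2" by auto
      \<comment> \<open>\<open>V1\<close> reveals the top \<open>m\<close> bits of the input. The
        direct signal at a level \<open>i < m\<close> uses only those, and the interference is fixed
        by \<open>w2\<close>.\<close>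
      have "X1 n m c u w2 (Suc j) $ (i - (q - n)) = X1 n m c w w2 (Suc j) $ (i - (q - n))"
        using ji mq by (intro level_eqD[OF V1_eqD[OF V]] X1 u w) auto
      then show "a ! j $ i = b ! j $ i"
        using ji u w by (simp add: Y1 level_index X1)
    qed auto
    \<comment> \<open>For \<open>n <= m\<close> the truncated difference \<open>n - m\<close> is 0,
      so all \<open>q\<close> levels count as free.\<close>
    show "card {?Y2 w1 w2 | w1 w2. w1 \<in> ?M1 \<and> w2 \<in> ?M2 \<and> V2 w2 = v}
        \<le> 2 ^ (N * card {min m (n - m)..<q})" for v
    proof (rule card_vec_lists_le[where q = q])
      let ?Z = "{?Y2 w1 w2 | w1 w2. w1 \<in> ?M1 \<and> w2 \<in> ?M2 \<and> V2 w2 = v}"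
      show "length a = N \<and> set a \<subseteq> carrier_vec q" if "a \<in> ?Z" for a
        using that set_Y2_block unfolding q_def by fastforce
      fix a b j i assume "a \<in> ?Z" "b \<in> ?Z" and ji: "j < N" "i < q" "i \<notin> {min m (n - m)..<q}"
      then obtain u1 u2 w1 w2 where u: "a = ?Y2 u1 u2" "u1 \<in> ?M1" "u2 \<in> ?M2"
        and w: "b = ?Y2 w1 w2" "w1 \<in> ?M1" "w2 \<in> ?M2" and V: "V2 u2 = V2 w2" by auto
      \<comment> \<open>The \<open>n - m\<close> top levels of receiver 2 are free of interference, and \<open>V\<^sub>2\<close> reveals the top \<open>m\<close>
        bits of \<open>X\<^sub>2\<close>.\<close>
      have im: "i < m" "i < n - m" using ji by auto
      then have q: "q = n" by (simp add: q_def)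
      have "enc2 c (Suc j) u2 $ i = enc2 c (Suc j) w2 $ i"
        using ji mq im by (intro level_eqD[OF V2_eqD[OF V]] X2 u w) auto
      then show "a ! j $ i = b ! j $ i"
        using ji im u w X1 X2 by (simp add: Y2 level_index q)
    qed auto
    show "V2 w2 = V2 w2'" if "?Y1 w1 w2 = ?Y1 w1 w2'" for w1 w2 w2'
    proof -
      have "level q m (enc2 c (Suc j) w2) = level q m (enc2 c (Suc j) w2')" if j: "j < N" for j
      proof -
        \<comment> \<open>Equal outputs mean equal feedback. With the same \<open>w1\<close>,
          transmitter 1 then sends the same input at time \<open>Suc j\<close>, and this input can
          be cancelled.\<close>
        have "Y1_block n m c w1 w2 j = Y1_block n m c w1 w2' j"
          using arg_cong[OF \<open>?Y1 w1 w2 = ?Y1 w1 w2'\<close>, of "take j"] j by (simp add: take_Y1_block)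
        then have "X1 n m c w1 w2 (Suc j) = X1 n m c w1 w2' (Suc j)" by (simp add: X1_def)
        then show ?thesis
          using arg_cong[OF \<open>?Y1 w1 w2 = ?Y1 w1 w2'\<close>, of "\<lambda>y. y ! j"] j unfolding q_def
          by (intro channel_cancel) (simp add: nth_Y1_block)
      qed
      then show ?thesis by (simp add: V2_def)
    qed
    show "V1 w1 w2 = V1 w1' w2" if "?Y2 w1 w2 = ?Y2 w1' w2" for w1 w1' w2
    proof -
      \<comment> \<open>Transmitter 2 has no feedback, so \<open>w2\<close> alone fixes the input to
        be cancelled.\<close>
      have "level q m (X1 n m c w1 w2 (Suc j)) = level q m (X1 n m c w1' w2 (Suc j))" if "j < N" for j
        using arg_cong[OF \<open>?Y2 w1 w2 = ?Y2 w1' w2\<close>, of "\<lambda>y. y ! j"] that unfolding q_def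
        by (intro channel_cancel) (simp add: nth_Y2_block)
      then show ?thesis by (simp add: V1_def)
    qed
  qed
  then show ?thesis 
    by (simp only: q_def distrib_left power_add mult.assoc card_lessThan card_atLeastLessThan)
qed

section \<open>Passage to rates and to the closure\<close>

lemma achievable_bound:
  assumes "achievable n m R1 R2"
  shows "2 * R1 + R2 \<le> max (real n - real m) 0 + max (real n) (real m)
           + max (real m) (real n - real m)"
proof (rule ccontr)
  define b where "b = max n m + (max n m - m) + (max n m - min m (n - m))"
  define d where "d = 2 * R1 + R2 - real b"
  have b: "real b = max (real n - real m) 0 + max (real n) (real m) + max (real m) (real n - real m)"
    unfolding b_def by (auto simp: max_def min_def)
  assume "\<not> ?thesis"
  then have "d > 0" using b by (simp add: d_def)
  from assms obtain C where R: "0 \<le> R1" "0 \<le> R2" and valid: "\<And>N. valid_code n m N R1 R2 (C N)"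
    and lim: "(\<lambda>N. error_prob1 n m N R1 R2 (C N)) \<longlonglongrightarrow> 0" "(\<lambda>N. error_prob2 n m N R1 R2 (C N)) \<longlonglongrightarrow> 0"
    unfolding achievable_def by blast
  have "\<forall>\<^sub>F N in sequentially. error_prob1 n m N R1 R2 (C N) < 1 / 8"
    "\<forall>\<^sub>F N in sequentially. error_prob2 n m N R1 R2 (C N) < 1 / 8"
    using lim[THEN order_tendstoD(2), of "1 / 8"] by simp_all
  \<comment> \<open>The constant is \<open>12 = 9 + 3\<close>: \<open>512 = 2 ^ 9\<close> comes from
    the counting bound, and \<open>8 = 2 ^ 3\<close> from rounding three message counts. A rate
    excess \<open>d > 0\<close> would force \<open>N * d <= 12\<close>.\<close>
  moreover have "\<forall>\<^sub>F N in sequentially. 12 / d < real N"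
    by (rule filterlim_at_top_dense[THEN iffD1, OF filterlim_real_sequentially, rule_format])
  ultimately have "\<forall>\<^sub>F N in sequentially. error_prob1 n m N R1 R2 (C N) < 1 / 8 \<and>
      error_prob2 n m N R1 R2 (C N) < 1 / 8 \<and> 12 / d < real N"
    by (simp add: eventually_conj_iff)
  then obtain N where e: "error_prob1 n m N R1 R2 (C N) < 1 / 8" "error_prob2 n m N R1 R2 (C N) < 1 / 8"
    and N: "12 / d < real N"
    using eventually_happens'[OF sequentially_bot] by blast
  let ?M1 = "card (messages N R1)" and ?M2 = "card (messages N R2)"
  let ?r = "2 powr (real N * R1) / 2" and ?s = "2 powr (real N * R2) / 2"
  have "2 powr (real N * (2 * R1 + R2)) / 8 = ?r * ?r * ?s"
  proof -
    have "real N * (2 * R1 + R2) = real N * R1 + real N * R1 + real N * R2"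
      by (simp add: distrib_left)
    then show ?thesis by (simp only: powr_add)
  qed
  also have "\<dots> \<le> real ?M1 * real ?M1 * real ?M2"
    using R by (intro mult_mono card_messages_ge) auto
  also have "\<dots> = real (?M1 * ?M1 * ?M2)" by simp
  also have "\<dots> \<le> real (512 * 2 ^ (N * b))"
    unfolding of_nat_le_iff b_def using valid R e by (rule code_count_bound)
  also have "\<dots> = 512 * 2 powr (real N * real b)"
    using powr_realpow[of 2 "N * b"] by simp
  finally have "2 powr (real N * (2 * R1 + R2)) \<le> 2 powr (12 + real N * real b)"
    by (simp add: powr_add)
  then have "real N * (2 * R1 + R2) \<le> 12 + real N * real b" by simp
  then have "real N * d \<le> 12" by (simp add: d_def algebra_simps)
  moreover have "12 < real N * d" using N \<open>d > 0\<close> by (simp add: divide_less_eq)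
  ultimately show False by simp
qed

theorem mainTheorem3:
  fixes n m :: nat and R1 R2 :: real
  assumes "(R1, R2) \<in> capacity_region_1000 n m"
  shows "2 * R1 + R2 \<le> max (real n - real m) 0 + max (real n) (real m)
           + max (real m) (real n - real m)"
proof -
  let ?H = "{p :: real \<times> real. 2 * fst p + snd p \<le> max (real n - real m) 0 + max (real n) (real m)
           + max (real m) (real n - real m)}"
  \<comment> \<open>A non-strict linear inequality is a closed condition, so it passes from
    achievable pairs to the closure.\<close>
  have "closed ?H" by (intro closed_Collect_le continuous_intros)
  moreover have "{(R1, R2). achievable n m R1 R2} \<subseteq> ?H"
    using achievable_bound by auto
  ultimately have "capacity_region_1000 n m \<subseteq> ?H"
    unfolding capacity_region_1000_def by (intro closure_minimal)
  then show ?thesis using assms by auto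
qed

end
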